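(* Let $N\ge 2$ be an integer, let $\tilde\psi_0,\dots,\tilde\psi_N$ be the dual Bernstein polynomials of degree $N$, and let $\tilde{\mathbf\Psi}=[\tilde\psi_0,\dots,\tilde\psi_N]^T$. Then $$\tilde{\mathbf\Psi}'=\mathbf P\,\tilde{\mathbf\Psi},$$ where $\mathbf P=[p_{i,j}]_{0\le i,j\le N}$ is given by $$p_{i,j}=\begin{cases}-(-1)^i(N+1)\binom{N+1}{i+1}+N\delta_{i,0}+\delta_{i,1}, & j=0,\\ -p_{N-i,0}, & j=N,\\ i, & j=i-1,\ j\ne 0,\\ N-2i, & j=i,\ j\neq 0,N,\\ -N+i, & j=i+1,\ j\ne N,\\ 0, & \text{otherwise.}\end{cases}$$
   Context: The Bernstein polynomials of degree $N$ on $[0,1]$ are $\phi_i(x)=\binom{N}{i}x^i(1-x)^{N-i}$, $0\le i\le N$. The dual Bernstein polynomials of degree $N$ are $\tilde\psi_i(x)=\sum_{j=0}^N c_{i,j}\phi_j(x)$, $0\le i\le N$, with $$c_{i,j}=\frac{(-1)^{i+j}}{\binom Ni\binom Nj}\sum_{r=0}^{\min(i,j)}(2r+1)\binom{N+r+1}{N-i}\binom{N-r}{N-i}\binom{N+r+1}{N-j}\binom{N-r}{N-j}.$$ They satisfy (known fact) $\int_0^1\phi_i\tilde\psi_j\,dx=\delta_{ij}$ for $0\le i,j\le N$, which characterizes them among polynomials of degree at most $N$. Here $\delta$ is the Kronecker delta and $\tilde{\mathbf\Psi}'$ is the entrywise derivative. *)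

theory Defs
  imports "HOL-Analysis.Analysis"
begin

text \<open>The Bernstein polynomials are \<^const>\<open>Bernstein\<close>, i.e.
  \<^term>\<open>Bernstein N i x\<close> is \<^term>\<open>real (N choose i) * x ^ i * (1 - x) ^ (N - i)\<close>.
  Polynomials are represented as functions on the reals, and (N + 1)-vectors and
  (N + 1) x (N + 1)-matrices as functions of natural-number indices, used only for
  indices at most N.\<close>

definition dual_bernstein_coeff :: "nat \<Rightarrow> nat \<Rightarrow> nat \<Rightarrow> real" where
  "dual_bernstein_coeff N i j =
     (- 1) ^ (i + j) / (real (N choose i) * real (N choose j)) *
     (\<Sum>r = 0..min i j.
        real (2 * r + 1) *
        real ((N + r + 1) choose (N - i)) * real ((N - r) choose (N - i)) *
        real ((N + r + 1) choose (N - j)) * real ((N - r) choose (N - j)))"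

definition dual_bernstein :: "nat \<Rightarrow> nat \<Rightarrow> real \<Rightarrow> real" where
  "dual_bernstein N i x = (\<Sum>j = 0..N. dual_bernstein_coeff N i j * Bernstein N j x)"

text \<open>Column 0 of the matrix is a separate function because column N refers to it.\<close>

definition deriv_matrix_col0 :: "nat \<Rightarrow> nat \<Rightarrow> real" where
  "deriv_matrix_col0 N i =
     - ((- 1) ^ i * real (N + 1) * real ((N + 1) choose (i + 1)))
     + real N * of_bool (i = 0) + of_bool (i = 1)"

text \<open>The condition \<open>i = j + 1\<close> expresses \<open>j = i - 1\<close> without truncated subtraction.\<close>

definition deriv_matrix :: "nat \<Rightarrow> nat \<Rightarrow> nat \<Rightarrow> real" where
  "deriv_matrix N i j =
     (if j = 0 then deriv_matrix_col0 N i
      else if j = N then - deriv_matrix_col0 N (N - i)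
      else if i = j + 1 then real i
      else if j = i then real N - 2 * real i
      else if j = i + 1 then - real N + real i
      else 0)"

end

theory Submission
  imports Defs
begin

text \<open>Let \<open>C\<close> be the symmetric coefficient matrix of the dual basis and \<open>D\<close> the tridiagonal matrix
  of differentiation in the Bernstein basis. Since
  \<open>P = - D\<^sup>T + C e\<^sub>N e\<^sub>N\<^sup>T - C e\<^sub>0 e\<^sub>0\<^sup>T\<close>, the theorem \<open>C D = P C\<close> is equivalent to
  \<open>C D + D\<^sup>T C = C e\<^sub>N (C e\<^sub>N)\<^sup>T - C e\<^sub>0 (C e\<^sub>0)\<^sup>T\<close>
  (integration by parts, when \<open>C\<close> is read as the inverse Gram matrix).
  Each entry of the left-hand side is a sum over \<open>r\<close> of hypergeometric terms, and this sum
  telescopes. No integral is needed.\<close>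

section \<open>Splitting of the dual coefficients into rank-one terms\<close>

definition dual_factor :: "nat \<Rightarrow> nat \<Rightarrow> nat \<Rightarrow> real" where
  "dual_factor N r j =
     (- 1) ^ j * real ((N + r + 1) choose (N - j)) * real ((N - r) choose (N - j)) / real (N choose j)"

lemma dual_factor_eq_0: "j \<le> N \<Longrightarrow> j < r \<Longrightarrow> r \<le> N \<Longrightarrow> dual_factor N r j = 0"
  by (simp add: dual_factor_def binomial_eq_0)

text \<open>Sign and denominator split between \<open>i\<close> and \<open>j\<close>. Terms with
  \<open>r > min i j\<close> vanish, so the range can be made independent of the indices; only then
  does a difference operator in \<open>j\<close> pass through the sum.\<close>

lemma dual_bernstein_coeff_eq_sum:
  assumes "i \<le> N" "j \<le> N"
  shows "dual_bernstein_coeff N i j =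
    (\<Sum>r = 0..N. (2 * real r + 1) * dual_factor N r i * dual_factor N r j)"
proof -
  have "dual_bernstein_coeff N i j =
      (\<Sum>r = 0..min i j. (2 * real r + 1) * dual_factor N r i * dual_factor N r j)"
    unfolding dual_bernstein_coeff_def dual_factor_def sum_distrib_left
    by (intro sum.cong) (simp_all add: power_add)
  also have "\<dots> = (\<Sum>r = 0..N. (2 * real r + 1) * dual_factor N r i * dual_factor N r j)"
    using assms by (intro sum.mono_neutral_left) (auto simp: dual_factor_eq_0 min_def split: if_splits)
  finally show ?thesis .
qed

lemma dual_bernstein_coeff_commute: "dual_bernstein_coeff N i j = dual_bernstein_coeff N j i"
  by (simp add: dual_bernstein_coeff_def min.commute add.commute mult_ac)

text \<open>Subtraction is done in the reals, so the identity covers \<open>k > n\<close> too, where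
  both sides are 0.\<close>

lemma binomial_absorb_comp_real: "(real n - real k) * real (n choose k) = real n * real ((n - 1) choose k)"
proof (cases "k \<le> n")
  case True
  then show ?thesis
    using binomial_absorb_comp[of n k] by (metis of_nat_diff of_nat_mult)
qed (simp add: not_le binomial_eq_0)

lemma binomial_Suc_absorb_real: "(real k + 1) * real (n choose Suc k) = (real n - real k) * real (n choose k)"
proof (cases "k \<le> n")
  case True
  then have "real (Suc k * (n choose Suc k)) = real ((n - k) * (n choose k))"
    by (simp only: binomial_absorption binomial_absorb_comp)
  with True show ?thesis
    by (simp add: of_nat_diff algebra_simps)
qed (simp add: not_le binomial_eq_0)

section \<open>Telescoping certificate and hypergeometric ratios\<close>

text \<open>The telescoping certificate is
  \<open>telescope_factor N r i * telescope_factor N r j * telescope_poly N i j r\<close>. The factor is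
  \<^const>\<open>dual_factor\<close> divided by \<open>(j + 1 - r) (N + 1 - j) / (N + 1 - r)\<close>, written so that
  it also makes sense at \<open>r = j + 1\<close>. The polynomial was found by interpolating the partial
  sums; it does not vanish at \<open>r = min i j + 1\<close> in general, so the sum has to run up to \<open>N\<close>.\<close>

definition telescope_factor :: "nat \<Rightarrow> nat \<Rightarrow> nat \<Rightarrow> real" where
  "telescope_factor N r j =
     (- 1) ^ j * real ((N + r + 1) choose (N - j)) * real ((N + 1 - r) choose (N - j))
       / ((real N + 1 - real j) * real (N choose j))"

definition telescope_poly :: "real \<Rightarrow> real \<Rightarrow> real \<Rightarrow> real \<Rightarrow> real" where
  "telescope_poly n i j r =
     (i + 1) * (j + 1) * (n + 2) * (n - i - j)
     + r^2 * (1 - n^2 - 2 * n + (n + 3) * (i + j) - 3 * i * j + (i + j)^2) - r^4"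

text \<open>The first of four ratio lemmas: each quantity in the telescoping claim is
  \<open>telescope_factor N r j\<close> times a rational function of \<open>N\<close>,
  \<open>r\<close>, \<open>j\<close>, with denominators \<open>N + 1 - r\<close> and
  \<open>r + j + 2\<close> that are positive for \<open>r <= N\<close>.\<close>

lemma dual_factor_eq:
  assumes "j \<le> N" "r \<le> N"
  shows "dual_factor N r j =
    telescope_factor N r j * ((real j + 1 - real r) * (real N + 1 - real j)) / (real N + 1 - real r)"
proof -
  \<comment> \<open>Absorption, with \<open>(N + 1 - r) - (N - j) = j + 1 - r\<close>.\<close>
  have *: "(real j + 1 - real r) * real ((N + 1 - r) choose (N - j)) =
      (real N + 1 - real r) * real ((N - r) choose (N - j))"
    using binomial_absorb_comp_real[of "N + 1 - r" "N - j"] assms by (simp add: of_nat_diff algebra_simps)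
  have "real N + 1 - real j \<noteq> 0" "real N + 1 - real r \<noteq> 0" "real (N choose j) \<noteq> 0"
    using assms by auto
  then have "telescope_factor N r j * ((real j + 1 - real r) * (real N + 1 - real j)) / (real N + 1 - real r) =
    (- 1) ^ j * real ((N + r + 1) choose (N - j)) *
      ((real j + 1 - real r) * real ((N + 1 - r) choose (N - j))) / ((real N + 1 - real r) * real (N choose j))"
    by (simp add: telescope_factor_def divide_simps)
  also have "\<dots> = dual_factor N r j"
    unfolding * using \<open>real N + 1 - real r \<noteq> 0\<close> by (simp add: dual_factor_def)
  finally show ?thesis ..
qed

lemma telescope_factor_Suc:
  assumes "j \<le> N" "r \<le> N"
  shows "telescope_factor N (Suc r) j =
    telescope_factor N r j * ((real N + real r + 2) * (real j + 1 - real r))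
      / ((real N + 1 - real r) * (real r + real j + 2))"
proof -
  let ?A = "real ((N + r + 1) choose (N - j))" and ?B = "real ((N + 1 - r) choose (N - j))"
  have nz: "real N + 1 - real j \<noteq> 0" "real N + 1 - real r \<noteq> 0" "real (N choose j) \<noteq> 0"
      "real r + real j + 2 \<noteq> 0"
    using assms by auto
  have B: "real ((N - r) choose (N - j)) = (real j + 1 - real r) * ?B / (real N + 1 - real r)"
    using binomial_absorb_comp_real[of "N + 1 - r" "N - j"] assms nz
    by (simp add: of_nat_diff field_simps)
  have A: "real ((N + r + 2) choose (N - j)) = (real N + real r + 2) * ?A / (real r + real j + 2)"
    using binomial_absorb_comp_real[of "N + r + 2" "N - j"] assms nz
    by (simp add: of_nat_diff field_simps)
  have "telescope_factor N (Suc r) j =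
      (- 1) ^ j * real ((N + r + 2) choose (N - j)) * real ((N - r) choose (N - j))
        / ((real N + 1 - real j) * real (N choose j))"
    by (simp add: telescope_factor_def)
  also have "\<dots> = telescope_factor N r j * ((real N + real r + 2) * (real j + 1 - real r))
      / ((real N + 1 - real r) * (real r + real j + 2))"
    unfolding A B by (simp add: telescope_factor_def mult_ac)
  finally show ?thesis .
qed

lemma dual_factor_Suc:
  assumes "j < N" "r \<le> N"
  shows "dual_factor N r (Suc j) =
    - telescope_factor N r j * ((real j + 1) * (real N + 1 - real j) * (real N - real j))
      / ((real r + real j + 2) * (real N + 1 - real r))"
proof -
  define m where "m = N - Suc j"
  let ?A = "real ((N + r + 1) choose (N - j))" and ?B = "real ((N + 1 - r) choose (N - j))"
  have m: "N - j = Suc m" "real m = real N - real j - 1"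
    using assms by (auto simp: m_def of_nat_diff)
  have nz: "real N + 1 - real j \<noteq> 0" "real N + 1 - real r \<noteq> 0" "real (N choose j) \<noteq> 0"
      "real r + real j + 2 \<noteq> 0" "real N - real j \<noteq> 0"
    using assms by auto
  have A: "real ((N + r + 1) choose m) = (real N - real j) * ?A / (real r + real j + 2)"
    using binomial_Suc_absorb_real[of m "N + r + 1"] nz by (simp add: m field_simps)
  have B: "real ((N - r) choose m) = (real N - real j) * ?B / (real N + 1 - real r)"
  proof -
    have "real (Suc m * ((N + 1 - r) choose Suc m)) = real ((N + 1 - r) * ((N - r) choose m))"
      using binomial_absorption[of m "N + 1 - r"] assms by (simp only:) simp
    then show ?thesis
      using nz assms by (simp add: m of_nat_diff field_simps)
  qed
  have C: "real (N choose Suc j) = (real N - real j) * real (N choose j) / (real j + 1)"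
    using binomial_Suc_absorb_real[of j N] by (simp add: field_simps)
  have "dual_factor N r (Suc j) =
      - ((- 1) ^ j * real ((N + r + 1) choose m) * real ((N - r) choose m) / real (N choose Suc j))"
    by (simp add: dual_factor_def m_def)
  also have "\<dots> = - telescope_factor N r j * ((real j + 1) * (real N + 1 - real j) * (real N - real j))
      / ((real r + real j + 2) * (real N + 1 - real r))"
    unfolding A B C telescope_factor_def using nz by (simp add: divide_simps)
  finally show ?thesis .
qed

text \<open>The prefactor \<open>real j\<close> matches the weight in \<open>bernstein_diff\<close>
  and neutralises the truncated index \<open>j - 1\<close> at \<open>j = 0\<close>.\<close>

lemma dual_factor_pred:
  assumes "j \<le> N" "r \<le> N"
  shows "real j * dual_factor N r (j - 1) =
    - telescope_factor N r j * ((real j + 1 - real r) * (real j - real r) * (real r + real j + 1))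
      / (real N + 1 - real r)"
proof (cases j)
  case 0
  \<comment> \<open>The right side must vanish too: \<open>(1 - r) * (0 - r)\<close> does so for
    \<open>r <= 1\<close>, and \<open>(N + 1 - r) choose N\<close> for
    \<open>r >= 2\<close>.\<close>
  then show ?thesis
    using assms by (cases "r \<le> 1") (auto simp: telescope_factor_def le_Suc_eq binomial_eq_0)
next
  case (Suc k)
  define m where "m = N - j"
  have m: "N - k = Suc m" "N - j = m" "real m = real N - real j"
    using assms by (auto simp: m_def Suc of_nat_diff)
  have nz: "real N + 1 - real j \<noteq> 0" "real N + 1 - real r \<noteq> 0" "real (N choose j) \<noteq> 0"
      "real (N choose k) \<noteq> 0" "real j \<noteq> 0"
    using assms Suc by auto
  have A: "real ((N + r + 1) choose Suc m) =
      (real r + real j + 1) * real ((N + r + 1) choose m) / (real N + 1 - real j)"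
    using binomial_Suc_absorb_real[of m "N + r + 1"] nz by (simp add: m field_simps)
  have B: "real ((N - r) choose Suc m) = (real j - real r) * real ((N - r) choose m) / (real N + 1 - real j)"
    using binomial_Suc_absorb_real[of m "N - r"] nz assms by (simp add: m of_nat_diff field_simps)
  have C: "real (N choose k) = real j * real (N choose j) / (real N + 1 - real j)"
    using binomial_Suc_absorb_real[of k N] nz Suc by (simp add: field_simps)
  have "real j * dual_factor N r (j - 1) =
      - (real j * ((- 1) ^ j * real ((N + r + 1) choose Suc m) * real ((N - r) choose Suc m) / real (N choose k)))"
    using Suc m by (simp add: dual_factor_def)
  also have "\<dots> = - dual_factor N r j * ((real j - real r) * (real r + real j + 1)) / (real N + 1 - real j)"
    unfolding A B C dual_factor_def m using nz by (simp add: divide_simps)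
  also have "\<dots> = - telescope_factor N r j * ((real j + 1 - real r) * (real j - real r) * (real r + real j + 1))
      / (real N + 1 - real r)"
    unfolding dual_factor_eq[OF assms] using nz by (simp add: divide_simps)
  finally show ?thesis .
qed

section \<open>Differentiation of the rank-one factors and telescoping\<close>

text \<open>The action of the transposed differentiation matrix on a vector indexed by \<open>0..N\<close>; its
  out-of-range entries, at \<open>j - 1\<close> for \<open>j = 0\<close> and at \<open>j + 1\<close> for \<open>j = N\<close>, are multiplied by 0.\<close>

definition bernstein_diff :: "nat \<Rightarrow> (nat \<Rightarrow> real) \<Rightarrow> nat \<Rightarrow> real" where
  "bernstein_diff N f j =
     (real N - real j) * f (Suc j) + (2 * real j - real N) * f j - real j * f (j - 1)"

lemma bernstein_diff_sum:
  "bernstein_diff N (\<lambda>j. \<Sum>r\<in>A. g r * f r j) j = (\<Sum>r\<in>A. g r * bernstein_diff N (f r) j)"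
  by (simp add: bernstein_diff_def sum_distrib_left sum.distrib sum_subtractf algebra_simps)

lemma bernstein_diff_dual_factor:
  assumes "j \<le> N" "r \<le> N"
  shows "bernstein_diff N (dual_factor N r) j =
    telescope_factor N r j / (real N + 1 - real r) *
      (- (real j + 1) * (real N + 1 - real j) * (real N - real j)^2 / (real r + real j + 2)
       + (2 * real j - real N) * (real j + 1 - real r) * (real N + 1 - real j)
       + (real j + 1 - real r) * (real j - real r) * (real r + real j + 1))"
proof -
  have nz: "real N + 1 - real r \<noteq> 0" "real r + real j + 2 \<noteq> 0"
    using assms by auto
  \<comment> \<open>\<open>dual_factor_Suc\<close> requires \<open>j < N\<close>; at
    \<open>j = N\<close> the weight \<open>N - j\<close> makes both sides 0.\<close>
  have "(real N - real j) * dual_factor N r (Suc j) = (real N - real j) *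
      (- telescope_factor N r j * ((real j + 1) * (real N + 1 - real j) * (real N - real j))
        / ((real r + real j + 2) * (real N + 1 - real r)))"
    using dual_factor_Suc[of j N r] assms by (cases "j = N") auto
  then show ?thesis
    unfolding bernstein_diff_def dual_factor_pred[OF assms] dual_factor_eq[OF assms]
    using nz by (simp add: divide_simps) (simp add: algebra_simps power2_eq_square)
qed

text \<open>For \<open>k\<close> equal to \<open>i\<close> or \<open>j\<close>, the functions
  \<open>A\<close>, \<open>U\<close>, \<open>R\<close> are the ratios to
  \<open>telescope_factor N r k\<close> of \<open>dual_factor N r k\<close>,
  \<open>bernstein_diff N (dual_factor N r) k\<close> and
  \<open>telescope_factor N (Suc r) k\<close>. Clearing denominators leaves a polynomial
  identity.\<close>

lemma telescope_identity:
  fixes n r i j :: real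
  assumes "n + 1 - r \<noteq> 0" "r + i + 2 \<noteq> 0" "r + j + 2 \<noteq> 0"
  defines "A \<equiv> \<lambda>k. (k + 1 - r) * (n + 1 - k) / (n + 1 - r)"
  defines "U \<equiv> \<lambda>k. 1 / (n + 1 - r) *
      (- (k + 1) * (n + 1 - k) * (n - k)^2 / (r + k + 2)
       + (2 * k - n) * (k + 1 - r) * (n + 1 - k)
       + (k + 1 - r) * (k - r) * (r + k + 1))"
  defines "R \<equiv> \<lambda>k. (n + r + 2) * (k + 1 - r) / ((n + 1 - r) * (r + k + 2))"
  shows "(2 * r + 1) * (A i * U j + A j * U i) =
    R i * R j * telescope_poly n i j (r + 1) - telescope_poly n i j r"
  unfolding A_def U_def R_def telescope_poly_def using assms(1-3)
  by (simp add: divide_simps) ((thin_tac "_ \<noteq> _")+, algebra)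

text \<open>The rational identity is multiplied by \<open>?h i * ?h j\<close>; nothing is divided by
  this product, which may be 0.\<close>

lemma dual_factor_telescope:
  assumes "i \<le> N" "j \<le> N" "r \<le> N"
  defines "F \<equiv> \<lambda>r. telescope_factor N r i * telescope_factor N r j * telescope_poly (real N) (real i) (real j) (real r)"
  shows "(2 * real r + 1) * (dual_factor N r i * bernstein_diff N (dual_factor N r) j
      + dual_factor N r j * bernstein_diff N (dual_factor N r) i) = F (Suc r) - F r"
proof -
  let ?n = "real N" and ?r = "real r" and ?h = "telescope_factor N r"
  define A where "A k = (k + 1 - ?r) * (?n + 1 - k) / (?n + 1 - ?r)" for k
  define U where "U k = 1 / (?n + 1 - ?r) *
      (- (k + 1) * (?n + 1 - k) * (?n - k)^2 / (?r + k + 2)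
       + (2 * k - ?n) * (k + 1 - ?r) * (?n + 1 - k)
       + (k + 1 - ?r) * (k - ?r) * (?r + k + 1))" for k
  define R where "R k = (?n + ?r + 2) * (k + 1 - ?r) / ((?n + 1 - ?r) * (?r + k + 2))" for k
  have A: "dual_factor N r k = ?h k * A (real k)" if "k \<le> N" for k
    using dual_factor_eq[OF that \<open>r \<le> N\<close>] by (simp add: A_def)
  have U: "bernstein_diff N (dual_factor N r) k = ?h k * U (real k)" if "k \<le> N" for k
    using bernstein_diff_dual_factor[OF that \<open>r \<le> N\<close>] by (simp add: U_def)
  have R: "telescope_factor N (Suc r) k = ?h k * R (real k)" if "k \<le> N" for k
    using telescope_factor_Suc[OF that \<open>r \<le> N\<close>] by (simp add: R_def)
  have identity: "(2 * ?r + 1) * (A i * U j + A j * U i) =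
      R i * R j * telescope_poly ?n i j (?r + 1) - telescope_poly ?n i j ?r"
    unfolding A_def U_def R_def using assms by (intro telescope_identity) auto
  have "(2 * ?r + 1) * (dual_factor N r i * bernstein_diff N (dual_factor N r) j
      + dual_factor N r j * bernstein_diff N (dual_factor N r) i) =
      (2 * ?r + 1) * (?h i * A i * (?h j * U j) + ?h j * A j * (?h i * U i))"
    using assms(1,2) by (simp only: A U)
  also have "\<dots> = ?h i * ?h j * ((2 * ?r + 1) * (A i * U j + A j * U i))"
    by algebra
  also have "\<dots> = ?h i * R i * (?h j * R j) * telescope_poly ?n i j (?r + 1)
      - ?h i * ?h j * telescope_poly ?n i j ?r"
    unfolding identity by algebra
  also have "\<dots> = F (Suc r) - F r"
    using assms(1,2) by (simp add: F_def R add.commute)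
  finally show ?thesis .
qed

text \<open>Upper end of the telescoping sum. At \<open>r = N + 1\<close> a binomial
  \<open>0 choose (N - k)\<close> appears, which is 0 unless \<open>k = N\<close>; in the remaining
  corner \<open>i = j = N\<close> the polynomial has a root.\<close>

lemma telescope_factor_top_mult:
  assumes "i \<le> N" "j \<le> N"
  shows "telescope_factor N (Suc N) i * telescope_factor N (Suc N) j
    * telescope_poly (real N) (real i) (real j) (real (Suc N)) = 0"
proof (cases "i = N \<and> j = N")
  case True
  have "telescope_poly n n n (n + 1) = 0" for n
    unfolding telescope_poly_def by algebra
  from this[of "real N"] True show ?thesis
    by (simp add: add.commute)
next
  case False
  with assms show ?thesis
    by (auto simp: telescope_factor_def binomial_eq_0)
qed

section \<open>Columns 0 and \<open>N\<close> of the coefficient matrix\<close>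

text \<open>Only \<open>r = 0\<close> contributes, and \<open>N choose (N - j)\<close> cancels the
  denominator.\<close>

lemma dual_bernstein_coeff_0:
  assumes "j \<le> N"
  shows "dual_bernstein_coeff N j 0 = (- 1) ^ j * (real N + 1) * real ((N + 1) choose (j + 1))"
proof -
  have "(N + 1) choose (j + 1) = (N + 1) choose (N - j)" "N choose (N - j) = N choose j"
    using assms binomial_symmetric[of "j + 1" "N + 1"] binomial_symmetric[of j N] by auto
  then show ?thesis
    using assms by (simp add: dual_bernstein_coeff_def)
qed

text \<open>Column \<open>N\<close> needs the full sum over \<open>r\<close>, which telescopes
  through \<open>g\<close>; \<open>g (Suc N)\<close> is 0 because of
  \<open>0 choose Suc m\<close>.\<close>

lemma sum_binomial_products:
  "(\<Sum>r = 0..N. (2 * real r + 1) * (real ((N + r + 1) choose m) * real ((N - r) choose m))) =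
    (real m + 1) * real ((N + 1) choose (m + 1)) ^ 2"
proof -
  define g where "g r = (real m + 1) * (real ((N + r + 1) choose Suc m) * real ((N + 1 - r) choose Suc m))" for r
  have step: "(2 * real r + 1) * (real ((N + r + 1) choose m) * real ((N - r) choose m)) = g r - g (Suc r)"
    if "r \<le> N" for r
  proof -
    let ?M = "real m + 1" and ?X = "real ((N + r + 1) choose m)" and ?Y = "real ((N - r) choose m)"
    \<comment> \<open>Times \<open>m + 1\<close>, each binomial of \<open>g r\<close> and
      \<open>g (Suc r)\<close> is a linear multiple of \<open>?X\<close> or \<open>?Y\<close>. What
      remains is \<open>(N+r+1-m)(N+1-r) - (N+r+2)(N-r-m) = (m+1)(2r+1)\<close>.\<close>
    have 1: "?M * real ((N + r + 1) choose Suc m) = (real N + real r + 1 - real m) * ?X"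
      using binomial_Suc_absorb_real[of m "N + r + 1"] by simp
    have 2: "?M * real ((N + 1 - r) choose Suc m) = (real N + 1 - real r) * ?Y"
    proof -
      have "real (Suc m) * real ((N + 1 - r) choose Suc m) = real (N + 1 - r) * real ((N - r) choose m)"
        using binomial_absorption[of m "N + 1 - r"] by (simp only: of_nat_mult[symmetric]) simp
      moreover have "real (N + 1 - r) = real N + 1 - real r"
        using that by (simp add: of_nat_diff)
      ultimately show ?thesis
        by (simp only: of_nat_Suc add.commute)
    qed
    have 3: "?M * real ((N + Suc r + 1) choose Suc m) = (real N + real r + 2) * ?X"
      using arg_cong[OF binomial_absorption[of m "N + r + 2"], of real]
      by (simp add: algebra_simps)
    have 4: "?M * real ((N + 1 - Suc r) choose Suc m) = (real N - real r - real m) * ?Y"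
      using binomial_Suc_absorb_real[of m "N - r"] that by (simp add: of_nat_diff)
    have "?M * (g r - g (Suc r)) =
        (?M * real ((N + r + 1) choose Suc m)) * (?M * real ((N + 1 - r) choose Suc m))
        - (?M * real ((N + Suc r + 1) choose Suc m)) * (?M * real ((N + 1 - Suc r) choose Suc m))"
      unfolding g_def by (simp only: algebra_simps)
    also have "\<dots> = ?M * ((2 * real r + 1) * (?X * ?Y))"
      unfolding 1 2 3 4 by algebra
    finally show ?thesis
      by (simp del: of_nat_Suc)
  qed
  have "(\<Sum>r = 0..N. (2 * real r + 1) * (real ((N + r + 1) choose m) * real ((N - r) choose m))) =
      (\<Sum>r\<le>N. g r - g (Suc r))"
    unfolding atLeast0AtMost by (intro sum.cong refl step) simp
  also have "\<dots> = g 0 - g (Suc N)"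
    by (rule sum_telescope)
  also have "\<dots> = (real m + 1) * real ((N + 1) choose (m + 1)) ^ 2"
    by (simp add: g_def power2_eq_square)
  finally show ?thesis .
qed

text \<open>The value is that of \<open>dual_bernstein_coeff N (N - j) 0\<close>, reflecting the
  symmetry \<open>x -> 1 - x\<close>.\<close>

lemma dual_bernstein_coeff_N:
  assumes "j \<le> N"
  shows "dual_bernstein_coeff N j N = (- 1) ^ (N - j) * (real N + 1) * real ((N + 1) choose (N - j + 1))"
proof -
  define m where "m = N - j"
  have sgn: "(- 1) ^ (j + N) = (- 1 :: real) ^ m"
    using assms by (simp add: m_def minus_one_power_iff)
  have m: "N choose j = N choose m"
    using assms binomial_symmetric[of j N] by (simp add: m_def)
  have nz: "real (N choose m) \<noteq> 0"
    using assms by (simp add: m_def)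
  have absorb: "(real m + 1) * real ((N + 1) choose (m + 1)) = (real N + 1) * real (N choose m)"
    using arg_cong[OF binomial_absorption[of m "N + 1"], of real] by (simp add: algebra_simps)
  \<comment> \<open>Both binomials in \<open>dual_factor N r N\<close> are \<open>choose 0\<close>,
    so that factor is just a sign.\<close>
  have "dual_bernstein_coeff N j N =
      (- 1) ^ m / real (N choose m) *
      (\<Sum>r = 0..N. (2 * real r + 1) * (real ((N + r + 1) choose m) * real ((N - r) choose m)))"
    unfolding dual_bernstein_coeff_eq_sum[OF assms order_refl] sum_distrib_left
    by (intro sum.cong) (simp_all add: dual_factor_def m flip: sgn m_def, simp add: power_add)
  also have "\<dots> = (- 1) ^ m / real (N choose m) * (real ((N + 1) choose (m + 1))
      * ((real m + 1) * real ((N + 1) choose (m + 1))))"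
    unfolding sum_binomial_products by (simp add: power2_eq_square)
  also have "\<dots> = (- 1) ^ m * (real N + 1) * real ((N + 1) choose (m + 1))"
    unfolding absorb using nz by simp
  finally show ?thesis
    by (simp add: m_def)
qed

text \<open>Puts the boundary columns in terms of \<open>telescope_factor N 0 j\<close>, for
  comparison with the lower end of the telescoping sum.\<close>

lemma dual_bernstein_coeff_boundary:
  assumes "j \<le> N"
  shows "dual_bernstein_coeff N j 0 = telescope_factor N 0 j * ((real N + 1 - real j) * (real j + 1))"
    and "dual_bernstein_coeff N j N = (- 1) ^ N * telescope_factor N 0 j * (real j + 1)^2"
proof -
  define m where "m = N - j"
  let ?B = "real ((N + 1) choose m)"
  have m: "real m = real N - real j" "N - j = m"
    using assms by (simp_all add: m_def of_nat_diff)
  have nz: "real N + 1 - real j \<noteq> 0" "real (N choose j) \<noteq> 0" "real j + 1 \<noteq> 0" "real N + 1 \<noteq> 0"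
    using assms by auto
  have "(real j + 1) * ?B = (real N + 1) * real (N choose j)"
    using binomial_absorb_comp_real[of "N + 1" m] m binomial_symmetric[OF assms]
    by (simp add: algebra_simps)
  then have C: "real (N choose j) = (real j + 1) * ?B / (real N + 1)"
    using nz by (simp add: field_simps)
  have B_nz: "?B \<noteq> 0"
    using nz C by auto
  have h: "telescope_factor N 0 j = (- 1) ^ j * (real N + 1) * ?B / ((real N + 1 - real j) * (real j + 1))"
    using nz B_nz unfolding telescope_factor_def C by (simp add: m divide_simps)
  have "(N + 1) choose (j + 1) = (N + 1) choose m"
    using assms binomial_symmetric[of "j + 1" "N + 1"] by (simp add: m_def)
  then show "dual_bernstein_coeff N j 0 = telescope_factor N 0 j * ((real N + 1 - real j) * (real j + 1))"
    unfolding dual_bernstein_coeff_0[OF assms] h using nz by simp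
  have S: "real ((N + 1) choose (m + 1)) = (real j + 1) * ?B / (real N + 1 - real j)"
    using binomial_Suc_absorb_real[of m "N + 1"] nz by (simp add: m field_simps)
  have sgn: "(- 1) ^ m = (- 1 :: real) ^ N * (- 1) ^ j"
    using assms by (simp add: m_def minus_one_power_iff)
  show "dual_bernstein_coeff N j N = (- 1) ^ N * telescope_factor N 0 j * (real j + 1)^2"
    unfolding dual_bernstein_coeff_N[OF assms] m S h sgn using nz
    by (simp add: divide_simps power2_eq_square)
qed

section \<open>Discrete integration by parts\<close>

text \<open>By biorthogonality the left side is the integral of the derivative of the product of
  dual polynomials \<open>i\<close> and \<open>j\<close>; \<open>c i N\<close> and
  \<open>c i 0\<close> are the values of polynomial \<open>i\<close> at 1 and 0.\<close>

lemma dual_bernstein_coeff_integration_by_parts: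
  assumes "i \<le> N" "j \<le> N"
  defines "c \<equiv> dual_bernstein_coeff N"
  shows "bernstein_diff N (c i) j + bernstein_diff N (c j) i = c i N * c j N - c i 0 * c j 0"
proof -
  define F where "F r = telescope_factor N r i * telescope_factor N r j
    * telescope_poly (real N) (real i) (real j) (real r)" for r
  have diff: "bernstein_diff N (c k) l =
      (\<Sum>r = 0..N. (2 * real r + 1) * dual_factor N r k * bernstein_diff N (dual_factor N r) l)"
    if "k \<le> N" "l \<le> N" for k l
  proof -
    \<comment> \<open>At \<open>l = N\<close> the out-of-range entry at \<open>Suc N\<close> has
      weight 0.\<close>
    have "bernstein_diff N (c k) l =
        bernstein_diff N (\<lambda>l. \<Sum>r = 0..N. (2 * real r + 1) * dual_factor N r k * dual_factor N r l) l"
      using that by (cases "l = N")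
        (simp_all add: bernstein_diff_def c_def dual_bernstein_coeff_eq_sum)
    then show ?thesis
      by (simp add: bernstein_diff_sum)
  qed
  have "bernstein_diff N (c i) j + bernstein_diff N (c j) i =
      (\<Sum>r = 0..N. (2 * real r + 1) * (dual_factor N r i * bernstein_diff N (dual_factor N r) j
        + dual_factor N r j * bernstein_diff N (dual_factor N r) i))"
    unfolding diff[OF assms(1,2)] diff[OF assms(2,1)] sum.distrib[symmetric]
    by (simp add: algebra_simps)
  also have "\<dots> = (\<Sum>r<Suc N. F (Suc r) - F r)"
    unfolding atLeast0AtMost lessThan_Suc_atMost F_def
    using assms by (intro sum.cong) (auto simp: dual_factor_telescope)
  also have "\<dots> = - F 0"
    unfolding sum_lessThan_telescope using telescope_factor_top_mult[OF assms(1,2)]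
    by (simp add: F_def)
  also have "\<dots> = c i N * c j N - c i 0 * c j 0"
  proof -
    have sq: "(- 1 :: real) ^ N * (- 1) ^ N = 1"
      by (simp flip: power_mult_distrib)
    have "c i N * c j N = ((- 1) ^ N * (- 1) ^ N) *
        (telescope_factor N 0 i * telescope_factor N 0 j * ((real i + 1)^2 * (real j + 1)^2))"
      unfolding c_def dual_bernstein_coeff_boundary(2)[OF assms(1)] dual_bernstein_coeff_boundary(2)[OF assms(2)]
      by (simp only: mult_ac)
    \<comment> \<open>At \<open>r = 0\<close> the polynomial splits into the column-0 weights minus
      the column-\<open>N\<close> weights.\<close>
    moreover have "telescope_poly n a b 0 =
        (n + 1 - a) * (a + 1) * ((n + 1 - b) * (b + 1)) - (a + 1)^2 * (b + 1)^2" for n a b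
      by (simp add: telescope_poly_def) algebra
    ultimately show ?thesis
      unfolding c_def dual_bernstein_coeff_boundary(1)[OF assms(1)] dual_bernstein_coeff_boundary(1)[OF assms(2)] sq F_def
      by (simp add: right_diff_distrib)
  qed
  finally show ?thesis .
qed

section \<open>Derivatives of the Bernstein polynomials\<close>

text \<open>Row \<open>k\<close> holds the coefficients of the derivative of
  \<open>Bernstein N k\<close> in the same basis. A sum of three indicator terms lets sums against
  it split into single entries.\<close>

definition bernstein_diff_matrix :: "nat \<Rightarrow> nat \<Rightarrow> nat \<Rightarrow> real" where
  "bernstein_diff_matrix N k j =
     (if k = Suc j then real N - real j else 0)
     + (if k = j then 2 * real j - real N else 0)
     - (if j = Suc k then real j else 0)"

lemma sum_bernstein_diff_matrix:
  assumes "j \<le> N"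
  shows "(\<Sum>k = 0..N. f k * bernstein_diff_matrix N k j) = bernstein_diff N f j"
proof -
  have "(\<Sum>k = 0..N. f k * (if j = Suc k then real j else 0)) = real j * f (j - 1)"
    using assms by (cases j) (auto simp: if_distrib[of "\<lambda>x. _ * x"] sum.delta' cong: if_cong)
  moreover have "(\<Sum>k = 0..N. f k * (if k = Suc j then real N - real j else 0)) = (real N - real j) * f (Suc j)"
    using assms by (auto simp: if_distrib[of "\<lambda>x. _ * x"] sum.delta cong: if_cong)
  moreover have "(\<Sum>k = 0..N. f k * (if k = j then 2 * real j - real N else 0)) = (2 * real j - real N) * f j"
    using assms by (auto simp: if_distrib[of "\<lambda>x. _ * x"] sum.delta cong: if_cong)
  ultimately show ?thesis
    unfolding bernstein_diff_matrix_def bernstein_diff_def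
    by (simp add: distrib_left right_diff_distrib sum.distrib sum_subtractf)
qed

text \<open>Degree elevation: the product rule gives terms of degree \<open>N - 1\<close>, which
  \<open>x + (1 - x) = 1\<close> raises to degree \<open>N\<close>.\<close>

lemma Bernstein_has_real_derivative:
  assumes "k \<le> N"
  shows "(Bernstein N k has_real_derivative
    (\<Sum>j = 0..N. bernstein_diff_matrix N k j * Bernstein N j x)) (at x)"
proof -
  let ?C = "real (N choose k)"
  have D: "(Bernstein N k has_real_derivative
      ?C * (real k * x ^ (k - 1) * (1 - x) ^ (N - k) - real (N - k) * x ^ k * (1 - x) ^ (N - k - 1))) (at x)"
    unfolding Bernstein_def by (auto intro!: derivative_eq_intros simp: algebra_simps)
  have 1: "(\<Sum>j = 0..N. (if k = Suc j then real N - real j else 0) * Bernstein N j x) =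
      ?C * (real k * x ^ (k - 1) * (1 - x) ^ (N - k) * (1 - x))"
  proof (cases k)
    case (Suc l)
    have "(\<Sum>j = 0..N. (if k = Suc j then real N - real j else 0) * Bernstein N j x) =
        (real N - real l) * Bernstein N l x"
      using assms Suc by (auto simp: if_distrib[of "\<lambda>x. x * _"] sum.delta' cong: if_cong)
    also have "\<dots> = ((real N - real l) * real (N choose l)) * (x ^ l * (1 - x) ^ (N - l))"
      by (simp add: Bernstein_def)
    also have "(real N - real l) * real (N choose l) = real k * ?C"
      using binomial_Suc_absorb_real[of l N] Suc by (simp add: algebra_simps)
    also have "N - l = Suc (N - k)"
      using assms Suc by simp
    finally show ?thesis
      using Suc by (simp add: mult_ac)
  qed simp
  have 2: "(\<Sum>j = 0..N. (if k = j then 2 * real j - real N else 0) * Bernstein N j x) =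
      ?C * ((2 * real k - real N) * x ^ k * (1 - x) ^ (N - k))"
    using assms by (auto simp: if_distrib[of "\<lambda>x. x * _"] sum.delta' Bernstein_def cong: if_cong)
  have 3: "(\<Sum>j = 0..N. (if j = Suc k then real j else 0) * Bernstein N j x) =
      ?C * (real (N - k) * x ^ k * (1 - x) ^ (N - k - 1) * x)"
  proof (cases "k = N")
    case False
    have "(\<Sum>j = 0..N. (if j = Suc k then real j else 0) * Bernstein N j x) =
        real (Suc k) * Bernstein N (Suc k) x"
      using assms False by (auto simp: if_distrib[of "\<lambda>x. x * _"] sum.delta cong: if_cong)
    also have "\<dots> = ((real k + 1) * real (N choose Suc k)) * (x ^ Suc k * (1 - x) ^ (N - Suc k))"
      by (simp add: Bernstein_def algebra_simps)
    also have "(real k + 1) * real (N choose Suc k) = real (N - k) * ?C"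
      using binomial_Suc_absorb_real[of k N] assms by (simp add: of_nat_diff)
    finally show ?thesis
      by (simp add: mult_ac)
  qed (auto intro!: sum.neutral)
  \<comment> \<open>Used with \<open>a = k * x ^ (k - 1)\<close>, \<open>v = x ^ k\<close>,
    \<open>b = (N - k) * (1 - x) ^ (N - k - 1)\<close>, \<open>w = (1 - x) ^ (N - k)\<close>. The
    two premises absorb the truncated exponents at \<open>k = 0\<close> and
    \<open>k = N\<close>.\<close>
  have comb: "a * w * (1 - x) + (2 * real k - real N) * v * w - b * v * x = a * w - b * v"
    if "a * x = real k * v" "b * (1 - x) = (real N - real k) * w" for a b v w
    using that by algebra
  have "real k * x ^ (k - 1) * x = real k * x ^ k"
    by (cases k) simp_all
  moreover have "real (N - k) * (1 - x) ^ (N - k - 1) * (1 - x) = (real N - real k) * (1 - x) ^ (N - k)"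
    using assms by (cases "N - k") (simp_all flip: of_nat_diff)
  ultimately have "real k * x ^ (k - 1) * (1 - x) ^ (N - k) * (1 - x)
        + (2 * real k - real N) * x ^ k * (1 - x) ^ (N - k)
        - real (N - k) * (1 - x) ^ (N - k - 1) * x ^ k * x
      = real k * x ^ (k - 1) * (1 - x) ^ (N - k) - real (N - k) * (1 - x) ^ (N - k - 1) * x ^ k"
    by (rule comb)
  then have "real k * x ^ (k - 1) * (1 - x) ^ (N - k) * (1 - x)
        + (2 * real k - real N) * x ^ k * (1 - x) ^ (N - k)
        - real (N - k) * x ^ k * (1 - x) ^ (N - k - 1) * x
      = real k * x ^ (k - 1) * (1 - x) ^ (N - k) - real (N - k) * x ^ k * (1 - x) ^ (N - k - 1)"
    by (simp only: mult_ac)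
  then have "(\<Sum>j = 0..N. bernstein_diff_matrix N k j * Bernstein N j x) =
      ?C * (real k * x ^ (k - 1) * (1 - x) ^ (N - k) - real (N - k) * x ^ k * (1 - x) ^ (N - k - 1))"
    unfolding bernstein_diff_matrix_def
    by (simp only: distrib_right left_diff_distrib sum.distrib sum_subtractf 1 2 3
        flip: distrib_left right_diff_distrib)
  with D show ?thesis by simp
qed

section \<open>The matrix \<open>P\<close> and the conclusion\<close>

text \<open>The Kronecker terms of column 0 are exactly the entries of \<open>- D^T\<close> there;
  column \<open>N\<close> follows by reflection. \<open>0 < N\<close> keeps these two columns
  distinct.\<close>

lemma deriv_matrix_eq:
  assumes "0 < N" "i \<le> N" "k \<le> N"
  shows "deriv_matrix N i k =
    (if k = N then dual_bernstein_coeff N i N else 0) - (if k = 0 then dual_bernstein_coeff N i 0 else 0)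
    - bernstein_diff_matrix N k i"
proof -
  have "deriv_matrix_col0 N l = - dual_bernstein_coeff N l 0 + real N * of_bool (l = 0) + of_bool (l = 1)"
    if "l \<le> N" for l
    using dual_bernstein_coeff_0[OF that] by (simp add: deriv_matrix_col0_def)
  moreover have "dual_bernstein_coeff N (N - i) 0 = dual_bernstein_coeff N i N"
    using assms by (simp add: dual_bernstein_coeff_0 dual_bernstein_coeff_N)
  ultimately show ?thesis
    using assms by (auto simp: deriv_matrix_def bernstein_diff_matrix_def)
qed

theorem lemma2:
  fixes N i :: nat and x :: real
  assumes "N \<ge> 2" and "i \<le> N"
  shows "(dual_bernstein N i has_real_derivative
            (\<Sum>j = 0..N. deriv_matrix N i j * dual_bernstein N j x)) (at x)"
proof -
  define c where "c = dual_bernstein_coeff N"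
  have CD: "(\<Sum>k = 0..N. deriv_matrix N i k * c k j) = (\<Sum>k = 0..N. c i k * bernstein_diff_matrix N k j)"
    if "j \<le> N" for j
  proof -
    \<comment> \<open>Symmetry replaces \<open>c k j\<close> by \<open>c j k\<close>, so the part
      from \<open>- D^T\<close> is \<open>bernstein_diff\<close> applied to row
      \<open>j\<close>.\<close>
    have "(\<Sum>k = 0..N. deriv_matrix N i k * c k j) =
        (\<Sum>k = 0..N. (if k = N then c i N * c j k else 0) - (if k = 0 then c i 0 * c j k else 0)
          - c j k * bernstein_diff_matrix N k i)"
      using assms dual_bernstein_coeff_commute[of N _ j]
      by (intro sum.cong) (auto simp: deriv_matrix_eq c_def algebra_simps)
    also have "\<dots> = c i N * c j N - c i 0 * c j 0 - bernstein_diff N (c j) i"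
      using assms by (simp add: sum_subtractf sum_bernstein_diff_matrix)
    also have "\<dots> = bernstein_diff N (c i) j"
      using dual_bernstein_coeff_integration_by_parts[OF assms(2) that] by (simp add: c_def)
    finally show ?thesis
      using that by (simp add: sum_bernstein_diff_matrix)
  qed
  have "(\<Sum>j = 0..N. deriv_matrix N i j * dual_bernstein N j x) =
      (\<Sum>j = 0..N. (\<Sum>k = 0..N. deriv_matrix N i k * c k j) * Bernstein N j x)"
    unfolding dual_bernstein_def c_def sum_distrib_left sum_distrib_right
    by (subst sum.swap) (simp add: mult_ac)
  also have "\<dots> = (\<Sum>j = 0..N. (\<Sum>k = 0..N. c i k * bernstein_diff_matrix N k j) * Bernstein N j x)"
    by (intro sum.cong) (auto simp: CD)
  also have "\<dots> = (\<Sum>k = 0..N. c i k * (\<Sum>j = 0..N. bernstein_diff_matrix N k j * Bernstein N j x))"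
    unfolding sum_distrib_left sum_distrib_right by (subst sum.swap) (simp add: mult_ac)
  finally show ?thesis
    unfolding dual_bernstein_def c_def
    by (auto intro!: DERIV_sum DERIV_cmult Bernstein_has_real_derivative)
qed

end
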